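(* There exists $\alpha_*$ with $\pi/4<\alpha_*<2\pi/7$ such that for every $\alpha\in(\alpha_*,3\pi/10)$ the following holds for the billiard map in the isosceles triangle with inner angles $(\alpha,\alpha,\pi-2\alpha)$ and base of length $1$. There exists an angle $\phi_*\in(0,\pi)$ such that the induced map on the base of the triangle $\{[k=1,\phi_*,x] : x\in[0,1]\}$ is a rotation on the unit interval, $$x\mapsto x+\omega \mod 1,\qquad \omega=\frac{\cos(3\alpha)}{2\cos(\alpha)\cos(4\alpha)},$$ where, as usual, the points $x\in\{0,1-\omega,1\}$, whose billiard orbits start at or run into a corner of the triangle, are disregarded.
   Context: Billiard table: an isosceles triangle with positively (counter-clockwise) oriented boundary, whose sides are labelled in counter-clockwise order by a cyclic index $k=1,2,3$ (indices mod 3). Side $k$ has length $s_k$; side $1$ is the base, $s_1=1$, and $s_2=s_3=1/(2\cos\alpha)$. The inner angle opposite side $k$ is $\gamma_k$, with $\gamma_2=\gamma_3=\alpha$ (the left and right inner angles at the base, respectively) and $\gamma_1=\pi-2\alpha$. A point particle moves along straight lines inside the triangle with elastic reflections at the sides. A bounce is recorded by a triplet $[k,\phi,x]$: $k$ is the side hit, $x\in[0,s_k]$ is the position of the bounce on side $k$, measured along the oriented side from its initial vertex (so $x=0$ on the base is its left endpoint), and $\phi\in(0,\pi)$ is the angle between the oriented side and the outgoing ray. The billiard map sends $[k,\phi,x]$ to the triplet $[k',\phi',x']$ of the next bounce, given by: if $k'=k+1$, then $\phi'=\pi-\phi-\gamma_{k-1}$ and $x'=(s_k-x)\sin(\phi)/\sin(\phi')$;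 if $k'=k-1$, then $\phi'=\pi-\phi+\gamma_{k+1}$ and $x'=s_{k'}-x\sin(\phi)/\sin(\phi')$. The induced map on the set $\{[1,\phi_*,x] : x\in[0,1]\}$ is the (first) return map: it sends $x$ to $x'$ if the billiard orbit started at $[1,\phi_*,x]$ next returns to this set (same side $k=1$, same angle $\phi_*$) at the point $[1,\phi_*,x']$. It is considered for those $x$ whose billiard orbit does not meet a corner of the triangle before returning. *)

theory Defs
  imports "HOL-Analysis.Analysis"
begin

text \<open>
  Sides are indexed by the three-element type \<open>3\<close> of \<^theory>\<open>HOL-Library.Numeral_Type\<close>, whose
  arithmetic is modulo 3; thus \<open>3 = 0\<close>, and \<open>k + 1\<close>, \<open>k - 1\<close> are the cyclic
  successor and predecessor of side \<open>k\<close>.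
\<close>

definition side_length :: "real \<Rightarrow> 3 \<Rightarrow> real" where
  "side_length \<alpha> k = (if k = 1 then 1 else 1 / (2 * cos \<alpha>))"

text \<open>The inner angle opposite side \<open>k\<close>; sides \<open>k\<close> and \<open>k + 1\<close> therefore enclose the angle
  with index \<open>k - 1\<close>.\<close>

definition inner_angle :: "real \<Rightarrow> 3 \<Rightarrow> real" where
  "inner_angle \<alpha> k = (if k = 1 then pi - 2 * \<alpha> else \<alpha>)"

text \<open>A bounce \<open>(k, \<phi>, x)\<close>: side, outgoing angle, position along the oriented side.\<close>

type_synonym bounce = "3 \<times> real \<times> real"

fun valid_bounce :: "real \<Rightarrow> bounce \<Rightarrow> bool" where
  "valid_bounce \<alpha> (k, \<phi>, x) \<longleftrightarrow> 0 < \<phi> \<and> \<phi> < pi \<and> 0 \<le> x \<and> x \<le> side_length \<alpha> k"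

fun at_corner :: "real \<Rightarrow> bounce \<Rightarrow> bool" where
  "at_corner \<alpha> (k, \<phi>, x) \<longleftrightarrow> x = 0 \<or> x = side_length \<alpha> k"

text \<open>
  The graph of the billiard map. Which of the two other sides is hit is decided by requiring that
  the image be a valid bounce, i.e. that the ray meets the segment and not merely the line
  containing it; lemma \<open>billiard_step_iff_geometric\<close> below confirms this. No step leaves a corner.
  A ray into the opposite corner is recorded as reaching an endpoint of either adjacent side;
  otherwise the image is unique.
\<close>

fun billiard_step :: "real \<Rightarrow> bounce \<Rightarrow> bounce \<Rightarrow> bool" where
  "billiard_step \<alpha> (k, \<phi>, x) (k', \<phi>', x') \<longleftrightarrow>
     valid_bounce \<alpha> (k, \<phi>, x) \<and> \<not> at_corner \<alpha> (k, \<phi>, x) \<and> valid_bounce \<alpha> (k', \<phi>', x') \<and>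
     (k' = k + 1 \<and> \<phi>' = pi - \<phi> - inner_angle \<alpha> (k - 1) \<and>
        x' = (side_length \<alpha> k - x) * sin \<phi> / sin \<phi>' \<or>
      k' = k - 1 \<and> \<phi>' = pi - \<phi> + inner_angle \<alpha> (k + 1) \<and>
        x' = side_length \<alpha> k' - x * sin \<phi> / sin \<phi>')"

definition billiard_orbit :: "real \<Rightarrow> nat \<Rightarrow> (nat \<Rightarrow> bounce) \<Rightarrow> bool" where
  "billiard_orbit \<alpha> n p \<longleftrightarrow> (\<forall>i<n. billiard_step \<alpha> (p i) (p (Suc i)))"

definition base_section :: "real \<Rightarrow> bounce set" where
  "base_section \<phi> = {(1, \<phi>, x) | x. 0 \<le> x \<and> x \<le> 1}"

text \<open>The graph of the first return map to \<open>base_section \<phi>\<close>, in the coordinate \<open>x\<close>.\<close>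

definition induced_map :: "real \<Rightarrow> real \<Rightarrow> real \<Rightarrow> real \<Rightarrow> bool" where
  "induced_map \<alpha> \<phi> x x' \<longleftrightarrow>
     (\<exists>n p. 0 < n \<and> billiard_orbit \<alpha> n p \<and> p 0 = (1, \<phi>, x) \<and> p n = (1, \<phi>, x') \<and>
        (\<forall>i\<le>n. \<not> at_corner \<alpha> (p i)) \<and>
        (\<forall>i. 0 < i \<and> i < n \<longrightarrow> p i \<notin> base_section \<phi>))"

text \<open>The orbit starts at a corner (\<open>n = 0\<close>) or runs into one no later than its first return.\<close>

definition meets_corner :: "real \<Rightarrow> real \<Rightarrow> real \<Rightarrow> bool" where
  "meets_corner \<alpha> \<phi> x \<longleftrightarrow>
     (\<exists>n p. billiard_orbit \<alpha> n p \<and> p 0 = (1, \<phi>, x) \<and> at_corner \<alpha> (p n) \<and>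
        (\<forall>i. 0 < i \<and> i < n \<longrightarrow> p i \<notin> base_section \<phi>))"

subsection \<open>Comparison with the geometric billiard\<close>

text \<open>The triangle in the complex plane, with the base from \<open>0\<close> to \<open>1\<close> and the apex above it.\<close>

definition side_start :: "real \<Rightarrow> 3 \<Rightarrow> complex" where
  "side_start \<alpha> k = (if k = 1 then 0 else if k = 2 then 1 else cis \<alpha> / of_real (2 * cos \<alpha>))"

definition side_dir :: "real \<Rightarrow> 3 \<Rightarrow> complex" where
  "side_dir \<alpha> k = (if k = 1 then 1 else if k = 2 then - cis (- \<alpha>) else - cis \<alpha>)"

definition side_point :: "real \<Rightarrow> 3 \<Rightarrow> real \<Rightarrow> complex" where
  "side_point \<alpha> k x = side_start \<alpha> k + of_real x * side_dir \<alpha> k"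

text \<open>The mirror image of a direction \<open>d\<close> in a line with unit direction \<open>u\<close>.\<close>

definition reflect_dir :: "complex \<Rightarrow> complex \<Rightarrow> complex" where
  "reflect_dir u d = u\<^sup>2 * cnj d"

lemma side_index_cases: "(k :: 3) = 1 \<or> k = 2 \<or> k = 0"
  using exhaust_3[of k] by auto

lemma side_index_neq: "(k' :: 3) \<noteq> k \<longleftrightarrow> k' = k + 1 \<or> k' = k - 1"
  using side_index_cases[of k] side_index_cases[of k'] by (elim disjE) simp_all

lemma inner_angle_bounds:
  assumes "0 < \<alpha>" "\<alpha> < pi / 2"
  shows "0 < inner_angle \<alpha> k" "inner_angle \<alpha> k < pi"
  using assms by (auto simp: inner_angle_def)

lemma side_start_Suc:
  assumes "0 < \<alpha>" "\<alpha> < pi / 2"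
  shows "side_start \<alpha> (k + 1) = side_point \<alpha> k (side_length \<alpha> k)"
proof -
  have c: "cos \<alpha> > 0" using assms by (intro cos_gt_zero_pi) auto
  have "cis \<alpha> + cis (- \<alpha>) = of_real (2 * cos \<alpha>)"
    by (simp add: complex_eq_iff)
  then have "cis \<alpha> / of_real (2 * cos \<alpha>) = 1 - cis (- \<alpha>) / of_real (2 * cos \<alpha>)"
    using c by (simp add: field_simps)
  then show ?thesis
    using side_index_cases[of k]
    by (elim disjE) (simp_all add: side_start_def side_point_def side_dir_def side_length_def)
qed

lemma side_dir_Suc: "side_dir \<alpha> (k + 1) = - side_dir \<alpha> k * cis (- inner_angle \<alpha> (k - 1))"
proof -
  have "cis (\<alpha> - pi) = - cis \<alpha>"
    by (simp add: complex_eq_iff cos_diff sin_diff)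
  then show ?thesis
    using side_index_cases[of k]
    by (elim disjE) (simp_all add: side_dir_def inner_angle_def cis_mult)
qed

lemma side_dir_pred: "side_dir \<alpha> (k - 1) = - side_dir \<alpha> k * cis (inner_angle \<alpha> (k + 1))"
proof -
  have k: "k - 1 - 1 = k + 1"
    using side_index_cases[of k] by (elim disjE) simp_all
  have "side_dir \<alpha> k = - side_dir \<alpha> (k - 1) * cis (- inner_angle \<alpha> (k + 1))"
    using side_dir_Suc[of \<alpha> "k - 1"] unfolding k diff_add_cancel .
  then show ?thesis by (simp add: mult.assoc cis_mult)
qed

lemma side_dir_unit: "side_dir \<alpha> k * cnj (side_dir \<alpha> k) = 1"
  by (simp add: side_dir_def cis_cnj cis_mult)

lemma cis_eq_minus_1_iff:
  assumes "0 < s" "s < 3 * pi"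
  shows "cis s = - 1 \<longleftrightarrow> s = pi"
proof
  assume "cis s = - 1"
  then have "cos (s - pi) = 1" by (simp add: complex_eq_iff cos_diff)
  then obtain n :: int where n: "s - pi = of_int n * (2 * pi)"
    by (metis cos_one_2pi_int mult.assoc)
  have "of_int n * (2 * pi) < 1 * (2 * pi)" "(-1) * (2 * pi) < of_int n * (2 * pi)"
    using assms n pi_gt_zero by linarith+
  then have "real_of_int n < 1" "-1 < real_of_int n"
    using pi_gt_zero by (metis mult_less_cancel_right_pos zero_less_mult_iff zero_less_numeral)+
  then have "n = 0" by linarith
  then show "s = pi" using n by simp
qed simp

text \<open>One reflection, seen from the bounce point: \<open>a\<close> and \<open>y\<close> are the distances of the old and new
  bounce points from the vertex between the two sides, and \<open>\<gamma>\<close> is the angle there.\<close>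

lemma reflect_next_iff:
  assumes \<gamma>: "0 < \<gamma>" "\<gamma> < pi" and \<phi>: "0 < \<phi>" "\<phi> < pi" and \<phi>': "0 < \<phi>'" "\<phi>' < pi"
    and a: "0 < a" and y: "0 \<le> y"
  shows "\<phi>' = pi - \<phi> - \<gamma> \<and> y = a * sin \<phi> / sin \<phi>' \<longleftrightarrow>
    (\<exists>t>0. of_real a - of_real y * cis (- \<gamma>) = of_real t * cis \<phi>) \<and>
    - cis (- \<gamma>) * cis \<phi>' = cis (- 2 * \<gamma>) * cis (- \<phi>)"
proof -
  have dir: "- cis (- \<gamma>) * cis \<phi>' = cis (- 2 * \<gamma>) * cis (- \<phi>) \<longleftrightarrow> \<phi>' = pi - \<phi> - \<gamma>"
  proof -
    have "- cis (- \<gamma>) * cis \<phi>' = cis (- 2 * \<gamma>) * cis (- \<phi>) \<longleftrightarrow>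
        cis (2 * \<gamma> + \<phi>) * (- cis (- \<gamma>) * cis \<phi>') = cis (2 * \<gamma> + \<phi>) * (cis (- 2 * \<gamma>) * cis (- \<phi>))"
      by (simp only: mult_cancel_left cis_neq_zero) simp
    also have "cis (2 * \<gamma> + \<phi>) * (- cis (- \<gamma>) * cis \<phi>') = - cis (\<phi>' + \<gamma> + \<phi>)"
      by (simp add: cis_mult algebra_simps)
    also have "cis (2 * \<gamma> + \<phi>) * (cis (- 2 * \<gamma>) * cis (- \<phi>)) = 1"
      by (simp add: cis_mult)
    also have "- cis (\<phi>' + \<gamma> + \<phi>) = 1 \<longleftrightarrow> cis (\<phi>' + \<gamma> + \<phi>) = - 1"
      by (metis minus_minus)
    also have "\<dots> \<longleftrightarrow> \<phi>' + \<gamma> + \<phi> = pi"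
      using assms by (intro cis_eq_minus_1_iff) auto
    finally show ?thesis by (simp add: algebra_simps)
  qed
  have pos: "(\<exists>t>0. of_real a - of_real y * cis (- \<gamma>) = of_real t * cis \<phi>) \<longleftrightarrow>
      y = a * sin \<phi> / sin \<phi>'" if e: "\<phi>' = pi - \<phi> - \<gamma>"
  proof -
    have s: "sin \<phi> > 0" "sin \<phi>' > 0" "sin \<gamma> > 0"
      using assms by (auto intro: sin_gt_zero)
    have s': "sin \<phi>' = sin \<phi> * cos \<gamma> + cos \<phi> * sin \<gamma>"
    proof -
      have "sin \<phi>' = sin (pi - (\<phi> + \<gamma>))" by (simp add: e algebra_simps)
      then show ?thesis by (simp only: sin_pi_minus sin_add)
    qed
    have eq: "of_real a - of_real y * cis (- \<gamma>) = of_real t * cis \<phi> \<longleftrightarrow>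
        a - y * cos \<gamma> = t * cos \<phi> \<and> y * sin \<gamma> = t * sin \<phi>" for t
      by (simp add: complex_eq_iff)
    show ?thesis
    proof
      assume "\<exists>t>0. of_real a - of_real y * cis (- \<gamma>) = of_real t * cis \<phi>"
      then obtain t where t: "a - y * cos \<gamma> = t * cos \<phi>" "y * sin \<gamma> = t * sin \<phi>"
        unfolding eq by blast
      have "y * sin \<phi>' = a * sin \<phi>"
        using t unfolding s' by algebra
      then show "y = a * sin \<phi> / sin \<phi>'" using s by (simp add: field_simps)
    next
      assume "y = a * sin \<phi> / sin \<phi>'"
      then have y': "y * sin \<phi>' = a * sin \<phi>" and "y > 0" using s a by simp_all
      define t where "t = y * sin \<gamma> / sin \<phi>"
      have t: "t > 0" "y * sin \<gamma> = t * sin \<phi>" using s \<open>y > 0\<close> by (simp_all add: t_def)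
      have "sin \<phi> * (a - y * cos \<gamma>) = sin \<phi> * (t * cos \<phi>)"
        using y' t(2) unfolding s' by algebra
      then have "a - y * cos \<gamma> = t * cos \<phi>" using s by simp
      with t show "\<exists>t>0. of_real a - of_real y * cis (- \<gamma>) = of_real t * cis \<phi>"
        unfolding eq by blast
    qed
  qed
  show ?thesis using dir pos by blast
qed

lemma reflect_pred_iff:
  assumes \<gamma>: "0 < \<gamma>" "\<gamma> < pi" and \<phi>: "0 < \<phi>" "\<phi> < pi" and \<phi>': "0 < \<phi>'" "\<phi>' < pi"
    and a: "0 < a" and y: "0 \<le> y"
  shows "\<phi>' = pi - \<phi> + \<gamma> \<and> y = a * sin \<phi> / sin \<phi>' \<longleftrightarrow>
    (\<exists>t>0. of_real y * cis \<gamma> - of_real a = of_real t * cis \<phi>) \<and>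
    - cis \<gamma> * cis \<phi>' = cis (2 * \<gamma>) * cis (- \<phi>)"
proof -
  have 1: "of_real a - of_real y * cis (- \<gamma>) = of_real t * cis (pi - \<phi>) \<longleftrightarrow>
      of_real y * cis \<gamma> - of_real a = of_real t * cis \<phi>" for t
    by (auto simp: complex_eq_iff)
  have 2: "- cis (- \<gamma>) * cis (pi - \<phi>') = cis (- 2 * \<gamma>) * cis (- (pi - \<phi>)) \<longleftrightarrow>
      - cis \<gamma> * cis \<phi>' = cis (2 * \<gamma>) * cis (- \<phi>)"
  proof -
    have "- cis (- \<gamma>) * cis (pi - \<phi>') = - cnj (- cis \<gamma> * cis \<phi>')"
      "cis (- 2 * \<gamma>) * cis (- (pi - \<phi>)) = - cnj (cis (2 * \<gamma>) * cis (- \<phi>))"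
      by (simp_all add: complex_eq_iff)
    then show ?thesis by (simp only: neg_equal_iff_equal complex_cnj_cancel_iff)
  qed
  have 3: "pi - \<phi>' = pi - (pi - \<phi>) - \<gamma> \<longleftrightarrow> \<phi>' = pi - \<phi> + \<gamma>" by auto
  show ?thesis
    using reflect_next_iff[of \<gamma> "pi - \<phi>" "pi - \<phi>'" a y] assms
    unfolding 1 2 3 by simp
qed

text \<open>A billiard step is straight motion to a point on another side followed by elastic
  reflection there.\<close>

lemma billiard_step_iff_geometric:
  assumes \<alpha>: "0 < \<alpha>" "\<alpha> < pi / 2"
  shows "billiard_step \<alpha> (k, \<phi>, x) (k', \<phi>', x') \<longleftrightarrow>
    valid_bounce \<alpha> (k, \<phi>, x) \<and> \<not> at_corner \<alpha> (k, \<phi>, x) \<and> valid_bounce \<alpha> (k', \<phi>', x') \<and>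
    k' \<noteq> k \<and>
    (\<exists>t>0. side_point \<alpha> k' x' = side_point \<alpha> k x + of_real t * (side_dir \<alpha> k * cis \<phi>)) \<and>
    side_dir \<alpha> k' * cis \<phi>' = reflect_dir (side_dir \<alpha> k') (side_dir \<alpha> k * cis \<phi>)"
proof (cases "valid_bounce \<alpha> (k, \<phi>, x) \<and> \<not> at_corner \<alpha> (k, \<phi>, x) \<and> valid_bounce \<alpha> (k', \<phi>', x')")
  case True
  then have \<phi>: "0 < \<phi>" "\<phi> < pi" "0 < \<phi>'" "\<phi>' < pi"
    and x: "0 < x" "0 < side_length \<alpha> k - x" "0 \<le> x'" "0 \<le> side_length \<alpha> k' - x'"
    by auto
  define u where "u = side_dir \<alpha> k"
  have u: "u * cnj u = 1" "u \<noteq> 0"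
    using side_dir_unit[of \<alpha> k] by (auto simp: u_def)
  have refl: "(- u * cis g) * cis \<phi>' = reflect_dir (- u * cis g) (u * cis \<phi>) \<longleftrightarrow>
      - cis g * cis \<phi>' = cis (2 * g) * cis (- \<phi>)" for g
  proof -
    have "reflect_dir (- u * cis g) (u * cis \<phi>) = (u * cnj u) * u * ((cis g)\<^sup>2 * cis (- \<phi>))"
      by (simp add: reflect_dir_def power2_eq_square cis_cnj)
    also have "\<dots> = u * (cis (2 * g) * cis (- \<phi>))"
      using u by (simp add: power2_eq_square cis_mult)
    finally have "reflect_dir (- u * cis g) (u * cis \<phi>) = u * (cis (2 * g) * cis (- \<phi>))" .
    moreover have "(- u * cis g) * cis \<phi>' = u * (- cis g * cis \<phi>')" by simp
    ultimately show ?thesis using u(2) by (metis mult_cancel_left)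
  qed
  have cancel: "u * v = of_real t * (u * w) \<longleftrightarrow> v = of_real t * w" for v w t
    using u(2) by (metis mult.left_commute mult_cancel_left)
  consider "k' = k + 1" | "k' = k - 1" | "k' = k" using side_index_neq[of k' k] by blast
  then show ?thesis
  proof cases
    case 1
    have k': "k + 1 \<noteq> k - 1" "k + 1 \<noteq> k" using side_index_cases[of k] by auto
    define g where "g = inner_angle \<alpha> (k - 1)"
    have g: "0 < g" "g < pi" using inner_angle_bounds[OF \<alpha>] by (auto simp: g_def)
    have d: "side_dir \<alpha> (k + 1) = - u * cis (- g)"
      unfolding u_def g_def by (rule side_dir_Suc)
    have "side_point \<alpha> (k + 1) x' - side_point \<alpha> k x =
        u * (of_real (side_length \<alpha> k - x) - of_real x' * cis (- g))"
      unfolding side_point_def[of \<alpha> "k + 1"] d side_start_Suc[OF \<alpha>]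
      by (simp add: side_point_def u_def algebra_simps)
    then have p: "side_point \<alpha> (k + 1) x' = side_point \<alpha> k x + of_real t * (u * cis \<phi>) \<longleftrightarrow>
        of_real (side_length \<alpha> k - x) - of_real x' * cis (- g) = of_real t * cis \<phi>" for t
      using cancel by (metis add_diff_cancel_left' diff_add_cancel add.commute)
    show ?thesis
      using True k' reflect_next_iff[OF g \<phi> x(2) x(3)]
      unfolding 1 billiard_step.simps u_def[symmetric] g_def[symmetric] d refl p by simp
  next
    case 2
    have k': "k - 1 \<noteq> k + 1" "k - 1 \<noteq> k" using side_index_cases[of k] by auto
    define g where "g = inner_angle \<alpha> (k + 1)"
    have g: "0 < g" "g < pi" using inner_angle_bounds[OF \<alpha>] by (auto simp: g_def)
    have d: "side_dir \<alpha> (k - 1) = - u * cis g"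
      unfolding u_def g_def by (rule side_dir_pred)
    have "side_start \<alpha> k = side_start \<alpha> (k - 1) + of_real (side_length \<alpha> (k - 1)) * (- u * cis g)"
      using side_start_Suc[OF \<alpha>, of "k - 1"] by (simp add: side_point_def d)
    then have "side_point \<alpha> (k - 1) x' - side_point \<alpha> k x =
        u * (of_real (side_length \<alpha> (k - 1) - x') * cis g - of_real x)"
      unfolding side_point_def d by (simp add: u_def algebra_simps)
    then have p: "side_point \<alpha> (k - 1) x' = side_point \<alpha> k x + of_real t * (u * cis \<phi>) \<longleftrightarrow>
        of_real (side_length \<alpha> (k - 1) - x') * cis g - of_real x = of_real t * cis \<phi>" for t
      using cancel by (metis add_diff_cancel_left' diff_add_cancel add.commute)
    have y: "0 \<le> side_length \<alpha> (k - 1) - x'" using x(4) 2 by simp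
    have e: "x' = side_length \<alpha> (k - 1) - x * sin \<phi> / sin \<phi>' \<longleftrightarrow>
        side_length \<alpha> (k - 1) - x' = x * sin \<phi> / sin \<phi>'" by auto
    show ?thesis
      using True k' reflect_pred_iff[OF g \<phi> x(1) y]
      unfolding 2 billiard_step.simps u_def[symmetric] g_def[symmetric] d refl p e by simp
  next
    case 3
    then show ?thesis using side_index_neq[of k k] by auto
  qed
next
  case False
  then show ?thesis by auto
qed

end

theory Submission
  imports Defs
begin

text \<open>
  Put \<open>u = 2 cos 2\<alpha>\<close>, so that \<open>\<omega> = (1 - u) / (2 - u\<^sup>2)\<close>, and choose \<open>\<phi>\<close> by
  \<open>sin (\<phi> + 2\<alpha>) = \<omega> sin \<phi>\<close>. A ray in this direction from \<open>x > 1 - \<omega>\<close> hits the sides 2, 1, 3 and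
  returns to the base shifted by \<open>\<omega> - 1\<close>; from \<open>x < 1 - \<omega>\<close> it hits 2, 3, 1, 3, 1, 2, 1, 2, 3
  and returns shifted by \<open>\<omega>\<close>; the ray from \<open>1 - \<omega>\<close> runs into the left end of the base. Up to a
  common factor the sines of all angles on the way are polynomials in \<open>u\<close>, times \<open>1 / (2 cos \<alpha>)\<close>
  on the legs, and the path exists as soon as \<open>1 + u - u\<^sup>2 > 0\<close>, which says \<open>\<alpha> < 3\<pi>/10\<close>,
  and \<open>(2 + u)(1 + u - u\<^sup>2) < 1\<close>, which holds for \<open>u < -11/25\<close>. The latter bound is weaker than
  \<open>\<alpha> \<ge> 2\<pi>/7\<close> because \<open>2 cos (4\<pi>/7) = -0.445\<dots>\<close>.
\<close>

section \<open>Determinism of the billiard map and its first returns\<close>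

text \<open>The three side vectors add up to zero; this is the component of their sum perpendicular
  to a ray leaving side \<open>k\<close> at angle \<phi>.\<close>

lemma triangle_closed:
  assumes "cos \<alpha> \<noteq> 0"
  shows "side_length \<alpha> (k + 1) * sin (\<phi> + inner_angle \<alpha> (k - 1)) +
    side_length \<alpha> (k - 1) * sin (\<phi> - inner_angle \<alpha> (k + 1)) = side_length \<alpha> k * sin \<phi>"
proof -
  have 1: "sin (\<phi> + \<alpha>) + sin (\<phi> - \<alpha>) = sin \<phi> * (2 * cos \<alpha>)"
    by (simp add: sin_add sin_diff)
  have 2: "sin (\<phi> + (pi - 2 * \<alpha>)) = - sin (\<phi> - 2 * \<alpha>)"
    "sin (\<phi> - (pi - 2 * \<alpha>)) = - sin (\<phi> + 2 * \<alpha>)"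
    by (simp_all add: sin_add sin_diff cos_diff)
  have 3: "2 * cos \<alpha> * sin (\<phi> - \<alpha>) - sin (\<phi> - 2 * \<alpha>) = sin \<phi>"
    using sin_times_cos[of "\<phi> - \<alpha>" \<alpha>] by (simp add: algebra_simps)
  have 4: "2 * cos \<alpha> * sin (\<phi> + \<alpha>) - sin (\<phi> + 2 * \<alpha>) = sin \<phi>"
    using sin_times_cos[of "\<phi> + \<alpha>" \<alpha>] by (simp add: algebra_simps)
  show ?thesis
    using side_index_cases[of k]
  proof (elim disjE)
    assume "k = 1"
    then show ?thesis using assms 1 by (simp add: side_length_def inner_angle_def field_simps)
  next
    assume "k = 2"
    then show ?thesis
      using assms 2 3 unfolding side_length_def inner_angle_def by (simp add: field_simps)
  next
    assume "k = 0"
    then show ?thesis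
      using assms 2 4 unfolding side_length_def inner_angle_def by (simp add: field_simps)
  qed
qed

text \<open>A ray meeting both other sides passes through their common corner, because the defects at the
  two sides are nonnegative and add up to zero by \<open>triangle_closed\<close>.\<close>

lemma billiard_step_deterministic:
  assumes "cos \<alpha> \<noteq> 0" and b: "billiard_step \<alpha> a b" and c: "billiard_step \<alpha> a c"
    and "\<not> at_corner \<alpha> b"
  shows "b = c"
proof -
  obtain k \<phi> x where a: "a = (k, \<phi>, x)" by (cases a)
  have False if d: "billiard_step \<alpha> (k, \<phi>, x) (k + 1, \<phi>1, x1)" "billiard_step \<alpha> (k, \<phi>, x) (k - 1, \<phi>2, x2)"
    and nc: "\<not> at_corner \<alpha> (k + 1, \<phi>1, x1) \<or> \<not> at_corner \<alpha> (k - 1, \<phi>2, x2)" for \<phi>1 x1 \<phi>2 x2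
  proof -
    have k: "k + 1 \<noteq> k - 1" using side_index_cases[of k] by auto
    have v: "0 < \<phi>1" "\<phi>1 < pi" "x1 \<le> side_length \<alpha> (k + 1)" "0 < \<phi>2" "\<phi>2 < pi" "0 \<le> x2"
      and e: "\<phi>1 = pi - \<phi> - inner_angle \<alpha> (k - 1)"
        "x1 = (side_length \<alpha> k - x) * sin \<phi> / sin \<phi>1"
        "\<phi>2 = pi - \<phi> + inner_angle \<alpha> (k + 1)"
        "x2 = side_length \<alpha> (k - 1) - x * sin \<phi> / sin \<phi>2"
      using d k by auto
    have s: "sin \<phi>1 > 0" "sin \<phi>2 > 0" using v by (auto intro: sin_gt_zero)
    have s1: "sin \<phi>1 = sin (\<phi> + inner_angle \<alpha> (k - 1))"
      using sin_pi_minus[of "\<phi> + inner_angle \<alpha> (k - 1)"] by (simp add: e(1) algebra_simps)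
    have s2: "sin \<phi>2 = sin (\<phi> - inner_angle \<alpha> (k + 1))"
      using sin_pi_minus[of "\<phi> - inner_angle \<alpha> (k + 1)"] by (simp add: e(3) algebra_simps)
    have x1: "x1 * sin \<phi>1 = (side_length \<alpha> k - x) * sin \<phi>" using e(2) s by simp
    have x2: "(side_length \<alpha> (k - 1) - x2) * sin \<phi>2 = x * sin \<phi>" using e(4) s by simp
    have "(side_length \<alpha> (k + 1) - x1) * sin \<phi>1 + x2 * sin \<phi>2 = 0"
      using triangle_closed[OF assms(1), of k \<phi>] x1 x2
      unfolding s1[symmetric] s2[symmetric] by (simp add: algebra_simps)
    moreover have "(side_length \<alpha> (k + 1) - x1) * sin \<phi>1 \<ge> 0" "x2 * sin \<phi>2 \<ge> 0"
      using v s by simp_all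
    ultimately have "(side_length \<alpha> (k + 1) - x1) * sin \<phi>1 = 0" "x2 * sin \<phi>2 = 0"
      by linarith+
    then have "x1 = side_length \<alpha> (k + 1)" "x2 = 0" using s by simp_all
    then show False using nc by simp
  qed
  note clash = this
  obtain kb \<phi>b xb where B: "b = (kb, \<phi>b, xb)" by (cases b)
  obtain kc \<phi>c xc where C: "c = (kc, \<phi>c, xc)" by (cases c)
  have "kb = k + 1 \<or> kb = k - 1" "kc = k + 1 \<or> kc = k - 1"
    using b c unfolding a B C by auto
  moreover have k: "k + 1 \<noteq> k - 1" "k - 1 \<noteq> k + 1" using side_index_cases[of k] by auto
  ultimately consider "kb = k + 1" "kc = k + 1" | "kb = k - 1" "kc = k - 1" |
    "kb = k + 1" "kc = k - 1" | "kb = k - 1" "kc = k + 1" by blast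
  then show ?thesis
  proof cases
    case 3
    then show ?thesis using clash b c assms(4) unfolding a B C by blast
  next
    case 4
    then show ?thesis using clash b c assms(4) unfolding a B C by blast
  qed (use b c k in \<open>auto simp: a B C\<close>)
qed

text \<open>Since no bounce of the path is a corner, determinism makes every orbit with the same
  start agree with it as long as both last. The return times coincide: ending earlier would put an
  inner point of the path into the section, and ending later would take the orbit through the
  section at the end of the path.\<close>

lemma induced_map_by_path:
  assumes "cos \<alpha> \<noteq> 0"
    and path: "successively (billiard_step \<alpha>) ((1, \<phi>, x) # bs @ [(1, \<phi>, x')])"
    and corner: "\<forall>b \<in> set ((1, \<phi>, x) # bs @ [(1, \<phi>, x')]). \<not> at_corner \<alpha> b"
    and base: "\<forall>b \<in> set bs. b \<notin> base_section \<phi>"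
  shows "induced_map \<alpha> \<phi> x y \<longleftrightarrow> y = x'"
proof -
  define xs where "xs = (1, \<phi>, x) # bs @ [(1, \<phi>, x')]"
  define N where "N = Suc (length bs)"
  have len: "length xs = Suc N" by (simp add: xs_def N_def)
  have q0: "xs ! 0 = (1, \<phi>, x)" and qN: "xs ! N = (1, \<phi>, x')"
    by (simp_all add: xs_def N_def nth_append)
  have step: "billiard_step \<alpha> (xs ! i) (xs ! Suc i)" if "i < N" for i
    using path that unfolding xs_def[symmetric] successively_conv_nth len by simp
  have nc: "\<not> at_corner \<alpha> (xs ! i)" if "i \<le> N" for i
    using corner that nth_mem[of i xs] unfolding xs_def[symmetric] len by simp
  have nb: "xs ! i \<notin> base_section \<phi>" if "0 < i" "i < N" for i
  proof -
    have "xs ! i = bs ! (i - 1)" "i - 1 < length bs"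
      using that by (auto simp: xs_def N_def nth_append nth_Cons')
    then show ?thesis using base nth_mem by metis
  qed
  have bN: "xs ! N \<in> base_section \<phi>"
    using step[of "N - 1"] qN
    by (cases "xs ! (N - 1)") (auto simp: N_def base_section_def side_length_def)
  show ?thesis
  proof
    assume "induced_map \<alpha> \<phi> x y"
    then obtain n p where n: "0 < n" and p: "\<And>i. i < n \<Longrightarrow> billiard_step \<alpha> (p i) (p (Suc i))"
      "p 0 = (1, \<phi>, x)" "p n = (1, \<phi>, y)"
      and pb: "\<And>i. 0 < i \<Longrightarrow> i < n \<Longrightarrow> p i \<notin> base_section \<phi>"
      unfolding induced_map_def billiard_orbit_def by blast
    have eq: "p i = xs ! i" if "i \<le> n" "i \<le> N" for i
      using that
    proof (induction i)
      case (Suc i)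
      then show ?case
        using billiard_step_deterministic[OF assms(1) step[of i], of "p (Suc i)"] p(1)[of i] nc[of "Suc i"]
        by simp
    qed (simp add: p q0)
    have bn: "p n \<in> base_section \<phi>"
      using p(1)[of "n - 1"] p(3) n
      by (cases "p (n - 1)") (auto simp: base_section_def side_length_def)
    have "n = N"
    proof (rule linorder_cases[of n N])
      assume "n < N"
      then show ?thesis using eq[of n] nb[of n] n bn by simp
    next
      assume "N < n"
      then show ?thesis using eq[of N] pb[of N] bN by (simp add: N_def)
    qed
    then show "y = x'" using eq[of n] p(3) qN by simp
  next
    assume "y = x'"
    moreover have "induced_map \<alpha> \<phi> x x'"
      unfolding induced_map_def billiard_orbit_def
      by (intro exI[of _ N] exI[of _ "(!) xs"]) (use step nc nb q0 qN in \<open>auto simp: N_def\<close>)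
    ultimately show "induced_map \<alpha> \<phi> x y" by simp
  qed
qed

text \<open>The position law is multiplied by the new sine, so that it becomes a polynomial identity
  once the sines are replaced by polynomials. \<open>billiard_step_predI\<close> does the same, with
  the new position measured from the end of its side.\<close>

lemma billiard_step_nextI:
  assumes "k' = k + 1" "0 < \<phi>" "\<phi> < pi" "0 < x" "x < side_length \<alpha> k"
    and "0 < \<phi>'" "\<phi>' < pi" "0 \<le> x'" "x' \<le> side_length \<alpha> k'"
    and "\<phi>' = pi - \<phi> - inner_angle \<alpha> (k - 1)"
    and "x' * sin \<phi>' = (side_length \<alpha> k - x) * sin \<phi>"
  shows "billiard_step \<alpha> (k, \<phi>, x) (k', \<phi>', x')"
proof -
  have "sin \<phi>' > 0" using assms by (intro sin_gt_zero)
  then have "x' = (side_length \<alpha> k - x) * sin \<phi> / sin \<phi>'" using assms(11) by (simp add: field_simps)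
  then show ?thesis using assms by auto
qed

lemma billiard_step_predI:
  assumes "k' = k - 1" "0 < \<phi>" "\<phi> < pi" "0 < x" "x < side_length \<alpha> k"
    and "0 < \<phi>'" "\<phi>' < pi" "0 \<le> x'" "x' \<le> side_length \<alpha> k'"
    and "\<phi>' = pi - \<phi> + inner_angle \<alpha> (k + 1)"
    and "(side_length \<alpha> k' - x') * sin \<phi>' = x * sin \<phi>"
  shows "billiard_step \<alpha> (k, \<phi>, x) (k', \<phi>', x')"
proof -
  have "sin \<phi>' > 0" using assms by (intro sin_gt_zero)
  then have "side_length \<alpha> k' - x' = x * sin \<phi> / sin \<phi>'" using assms(11) by (simp add: field_simps)
  then have "x' = side_length \<alpha> k' - x * sin \<phi> / sin \<phi>'" by simp
  then show ?thesis using assms by auto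
qed

section \<open>Sines and angles along the orbit\<close>

text \<open>The reflection law involves only ratios of sines, so \<kappa> is a common scale;
  \<open>sin_0\<close> and \<open>sin_2\<close> fix the ratio \<omega>. \<open>P_pos\<close>
  confines the angles (\<open>angle_6\<close>), and \<open>Q_less_1\<close> keeps the bounces on the
  legs between their endpoints.\<close>

locale rotation_triangle =
  fixes \<alpha> \<phi> u \<kappa> :: real
  assumes \<alpha>: "pi / 4 < \<alpha>" "\<alpha> < 3 * pi / 10"
    and \<phi>: "0 < \<phi>" "\<phi> < pi"
    and u_def: "u = 2 * cos (2 * \<alpha>)"
    and Q_less_1: "(2 + u) * (1 + u - u\<^sup>2) < 1"
    and P_pos: "0 < 1 + u - u\<^sup>2"
    and \<kappa>: "0 < \<kappa>"
    and sin_0: "sin \<phi> = (2 - u\<^sup>2) * \<kappa>"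
    and sin_2: "sin (\<phi> + 2 * \<alpha>) = (1 - u) * \<kappa>"
begin

definition "s = 1 / (2 * cos \<alpha>)"
text \<open>\<open>A\<close> and \<open>Q\<close> are \<open>1 - u\<close> and \<open>P\<close>
  divided by \<open>s * s\<close>, because \<open>A = (2 + u) * (1 - u)\<close> and
  \<open>s * s = 1 / (2 + u)\<close>. They appear when positions on the legs are measured in units
  of \<open>s\<close>.\<close>

definition "A = 2 - u - u\<^sup>2"
definition "P = 1 + u - u\<^sup>2"
definition "Q = (2 + u) * P"

lemma cos_pos: "cos \<alpha> > 0"
  using \<alpha> pi_gt_zero by (intro cos_gt_zero_pi) linarith+

lemma s_pos: "s > 0"
  using cos_pos by (simp add: s_def)

lemma s_square: "s * s = 1 / (2 + u)"
  using cos_pos cos_double_cos[of \<alpha>]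
  by (simp add: s_def u_def power2_eq_square divide_simps)

lemma u_bounds: "- 1 < u" "u < 0"
proof -
  show "u < 0"
    unfolding u_def using cos_monotone_0_pi[of "pi / 2" "2 * \<alpha>"] \<alpha> pi_gt_zero by simp
  show "- 1 < u"
    unfolding u_def
    using cos_monotone_0_pi[of "2 * \<alpha>" "2 * pi / 3"] \<alpha> pi_gt_zero cos_120'
    by (simp add: field_simps)
qed

lemma u_square: "0 < u\<^sup>2" "u\<^sup>2 < 1"
  using u_bounds by (simp_all add: abs_square_less_1)

lemma bounds: "0 < A" "0 < P" "P < 1" "0 < Q" "Q < 1" "0 < 2 - u\<^sup>2" "0 < 3 - u\<^sup>2"
proof -
  show "0 < A" "0 < P" "Q < 1" "0 < 2 - u\<^sup>2" "0 < 3 - u\<^sup>2"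
    using u_bounds u_square P_pos Q_less_1 by (simp_all add: A_def P_def Q_def)
  show "P < 1"
    using u_bounds u_square unfolding P_def by linarith
  show "0 < Q"
    using u_bounds P_pos by (simp add: P_def Q_def)
qed

text \<open>Supplies the sines at odd multiples of \<alpha> from those at even multiples, which come
  from the three-term recurrence \<open>sin_double_step\<close>. This is the origin of the factor
  \<open>s\<close> in the odd ones.\<close>

lemma sin_step: "sin \<theta> = s * (sin (\<theta> + \<alpha>) + sin (\<theta> - \<alpha>))"
  using cos_pos by (simp add: s_def sin_add sin_diff)

lemma sin_double_step: "sin (\<theta> + 4 * \<alpha>) = u * sin (\<theta> + 2 * \<alpha>) - sin \<theta>"
proof -
  have "sin (\<theta> + 4 * \<alpha>) + sin \<theta> = u * sin (\<theta> + 2 * \<alpha>)"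
    using sin_times_cos[of "\<theta> + 2 * \<alpha>" "2 * \<alpha>"] by (simp add: u_def algebra_simps)
  then show ?thesis by simp
qed

lemma sin_4: "sin (\<phi> + 4 * \<alpha>) = - ((2 - u) * \<kappa>)"
  unfolding sin_double_step sin_0 sin_2 by (simp add: power2_eq_square algebra_simps)

lemma sin_6: "sin (\<phi> + 6 * \<alpha>) = - (P * \<kappa>)"
proof -
  have "sin (\<phi> + 6 * \<alpha>) = u * sin (\<phi> + 4 * \<alpha>) - sin (\<phi> + 2 * \<alpha>)"
    using sin_double_step[of "\<phi> + 2 * \<alpha>"] by (simp add: algebra_simps)
  then show ?thesis
    unfolding sin_2 sin_4 by (simp add: P_def power2_eq_square algebra_simps)
qed

lemma sin_1: "sin (\<phi> + \<alpha>) = s * (A + 1) * \<kappa>"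
proof -
  have "sin (\<phi> + \<alpha>) = s * (sin (\<phi> + 2 * \<alpha>) + sin (\<phi>))"
    using sin_step[of "\<phi> + \<alpha>"] by (simp add: algebra_simps)
  then show ?thesis
    unfolding sin_0 sin_2 by (simp add: A_def P_def power2_eq_square algebra_simps)
qed

lemma sin_3: "sin (\<phi> + 3 * \<alpha>) = - (s * \<kappa>)"
proof -
  have "sin (\<phi> + 3 * \<alpha>) = s * (sin (\<phi> + 4 * \<alpha>) + sin (\<phi> + 2 * \<alpha>))"
    using sin_step[of "\<phi> + 3 * \<alpha>"] by (simp add: algebra_simps)
  then show ?thesis
    unfolding sin_2 sin_4 by (simp add: A_def P_def power2_eq_square algebra_simps)
qed

lemma sin_5: "sin (\<phi> + 5 * \<alpha>) = - (s * (3 - u\<^sup>2) * \<kappa>)"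
proof -
  have "sin (\<phi> + 5 * \<alpha>) = s * (sin (\<phi> + 6 * \<alpha>) + sin (\<phi> + 4 * \<alpha>))"
    using sin_step[of "\<phi> + 5 * \<alpha>"] by (simp add: algebra_simps)
  then show ?thesis
    unfolding sin_4 sin_6 by (simp add: A_def P_def power2_eq_square algebra_simps)
qed

text \<open>Here and in the next two lemmas the sign of a sine locates the angle: the crude bounds
  confine a violating angle to a single half turn, on which the sine has the wrong sign.\<close>

lemma angle_2: "\<phi> + 2 * \<alpha> < pi"
proof (rule ccontr)
  assume "\<not> ?thesis"
  then have "0 \<le> sin (\<phi> + 2 * \<alpha> - pi) "
    using \<phi> \<alpha> pi_gt_zero by (intro sin_ge_zero) linarith+
  moreover have "sin (\<phi> + 2 * \<alpha>) > 0" using sin_2 u_bounds \<kappa> by simp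
  ultimately show False by simp
qed

lemma angle_3: "pi < \<phi> + 3 * \<alpha>"
proof (rule ccontr)
  assume "\<not> ?thesis"
  then have "0 \<le> sin (\<phi> + 3 * \<alpha>)"
    using \<phi> \<alpha> pi_gt_zero by (intro sin_ge_zero) linarith+
  then show False using sin_3 s_pos \<kappa> by (simp add: mult_le_0_iff)
qed

lemma angle_6: "\<phi> + 6 * \<alpha> < 2 * pi"
proof (rule ccontr)
  assume "\<not> ?thesis"
  then have "0 \<le> sin (\<phi> + 6 * \<alpha> - 2 * pi)"
    using \<phi> \<alpha> pi_gt_zero angle_2 by (intro sin_ge_zero) linarith+
  moreover have "sin (\<phi> + 6 * \<alpha>) < 0"
    using sin_6 bounds \<kappa> by simp
  ultimately show False by (simp add: sin_diff)
qed

text \<open>These bounds place every outgoing angle of both return paths strictly between 0 and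
  \<open>pi\<close>.\<close>

lemmas angles = \<phi> \<alpha> angle_2 angle_3 angle_6

lemma sines:
  "sin (pi - \<phi> - \<alpha>) = s * (A + 1) * \<kappa>"
  "sin (\<phi> + 3 * \<alpha> - pi) = s * \<kappa>"
  "sin (2 * pi - \<phi> - 4 * \<alpha>) = (2 - u) * \<kappa>"
  "sin (\<phi> + 5 * \<alpha> - pi) = s * (3 - u\<^sup>2) * \<kappa>"
  "sin (2 * pi - \<phi> - 6 * \<alpha>) = P * \<kappa>"
proof -
  have "sin (pi - \<phi> - \<alpha>) = sin (\<phi> + \<alpha>)"
    using sin_pi_minus[of "\<phi> + \<alpha>"] by (simp add: algebra_simps)
  moreover have "sin (2 * pi - \<phi> - \<theta>) = - sin (\<phi> + \<theta>)" for \<theta>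
    using sin_2pi_minus[of "\<phi> + \<theta>"] by (simp add: algebra_simps)
  ultimately show
    "sin (pi - \<phi> - \<alpha>) = s * (A + 1) * \<kappa>"
    "sin (\<phi> + 3 * \<alpha> - pi) = s * \<kappa>"
    "sin (2 * pi - \<phi> - 4 * \<alpha>) = (2 - u) * \<kappa>"
    "sin (\<phi> + 5 * \<alpha> - pi) = s * (3 - u\<^sup>2) * \<kappa>"
    "sin (2 * pi - \<phi> - 6 * \<alpha>) = P * \<kappa>"
    using sin_1 sin_3 sin_4 sin_5 sin_6 by simp_all
qed

lemma side_lengths: "side_length \<alpha> 0 = s" "side_length \<alpha> 1 = 1" "side_length \<alpha> 2 = s"
  by (simp_all add: side_length_def s_def)

lemma inner_angles: "inner_angle \<alpha> 0 = \<alpha>" "inner_angle \<alpha> 1 = pi - 2 * \<alpha>" "inner_angle \<alpha> 2 = \<alpha>"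
  "inner_angle \<alpha> (- 1) = \<alpha>" "inner_angle \<alpha> 3 = \<alpha>"
  by (simp_all add: inner_angle_def)

section \<open>The two return paths and the rotation\<close>

text \<open>This is \<open>sin (\<phi> + 2 * \<alpha>) / sin \<phi>\<close>; its agreement with the
  quotient of cosines is checked in \<open>theorem1\<close>.\<close>

definition "\<omega> = (1 - u) / (2 - u\<^sup>2)"

lemma \<omega>_bounds: "0 < \<omega>" "\<omega> < 1"
  using bounds u_bounds by (simp_all add: \<omega>_def P_def divide_simps)

lemma \<omega>_mult: "\<omega> * (2 - u\<^sup>2) = 1 - u" "(1 - \<omega>) * (2 - u\<^sup>2) = P"
  using bounds by (simp_all add: \<omega>_def P_def field_simps)

lemma s_square_mult: "s * s * A = 1 - u" "s * s * Q = P"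
  using u_bounds unfolding s_square
  by (simp_all add: A_def Q_def power2_eq_square field_simps)

lemmas step_simps = side_lengths inner_angles sines sin_0 sin_2

text \<open>Positions on the legs are written as multiples of the leg length \<open>s\<close>.\<close>

lemma first_step:
  assumes "0 < x" "x < 1" "0 < w" "w < 1" "(1 - x) * (2 - u\<^sup>2) = s * s * (w * (A + 1))"
  shows "billiard_step \<alpha> (1, \<phi>, x) (2, pi - \<phi> - \<alpha>, s * w)"
  by (rule billiard_step_nextI) (use assms angles s_pos in \<open>simp_all add: step_simps\<close>)

lemma second_step_right:
  assumes "0 < v" "v \<le> 1" "w * (A + 1) = v * A"
  shows "billiard_step \<alpha> (2, pi - \<phi> - \<alpha>, s * w) (1, \<phi> + 2 * \<alpha>, 1 - v)"
proof (rule billiard_step_predI)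
  have "v * A \<le> 1 * A"
    using assms bounds by (intro mult_right_mono) simp_all
  then have "0 < v * A" "v * A < A + 1"
    using mult_pos_pos[OF assms(1) bounds(1)] by linarith+
  moreover have "w = v * A / (A + 1)"
    using assms bounds by (simp add: field_simps)
  ultimately have "0 < w" "w < 1" using bounds by simp_all
  then show "0 < s * w" "s * w < side_length \<alpha> 2"
    using s_pos by (simp_all add: side_lengths)
  show "(side_length \<alpha> 1 - (1 - v)) * sin (\<phi> + 2 * \<alpha>) = s * w * sin (pi - \<phi> - \<alpha>)"
    unfolding step_simps using s_square_mult(1) assms(3) by algebra
qed (use assms angles in \<open>simp_all add: step_simps\<close>)

lemma induced_map_right:
  assumes "1 - \<omega> < x" "x < 1"
  shows "induced_map \<alpha> \<phi> x x' \<longleftrightarrow> x' = x + \<omega> - 1"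
proof -
  \<comment> \<open>The intermediate base bounce lies at \<open>1 - v\<close>. Read backwards and
    mirrored in the axis of the triangle, the path becomes the one for \<open>1 - v\<close>; hence
    \<open>w'\<close> is \<open>w\<close> with \<open>v\<close> replaced by \<open>1 - v\<close>,
    measured from the left end of the base.\<close>
  define v where "v = (1 - x) / \<omega>"
  have v: "0 < v" "v < 1" and x: "1 - x = v * \<omega>"
    using assms \<omega>_bounds by (simp_all add: v_def field_simps)
  define w where "w = v * A / (A + 1)"
  define w' where "w' = (1 - v) * A / (A + 1)"
  have w: "0 < w" "w * (A + 1) = v * A" "0 < w'" "w' * (A + 1) = (1 - v) * A"
    using v bounds by (simp_all add: w_def w'_def)
  have "v * A < 1 * A" "(1 - v) * A < 1 * A"
    using v bounds by (intro mult_strict_right_mono; simp)+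
  then have "v * A < A + 1" "(1 - v) * A < A + 1" by linarith+
  then have w1: "w < 1" "w' < 1"
    using bounds by (simp_all add: w_def w'_def)
  have x': "0 < x + \<omega> - 1" "x + \<omega> - 1 < 1" "0 < x" 
    using assms \<omega>_bounds by linarith+
  have "(1 - x) * (2 - u\<^sup>2) = s * s * (w * (A + 1))"
    using s_square_mult \<omega>_mult w x by algebra
  then have 1: "billiard_step \<alpha> (1, \<phi>, x) (2, pi - \<phi> - \<alpha>, s * w)"
    using assms x' w w1 by (intro first_step) simp_all
  have 2: "billiard_step \<alpha> (2, pi - \<phi> - \<alpha>, s * w) (1, \<phi> + 2 * \<alpha>, 1 - v)"
    using v w by (intro second_step_right) auto
  have 3: "billiard_step \<alpha> (1, \<phi> + 2 * \<alpha>, 1 - v) (0, pi - \<phi> - \<alpha>, s * (1 - w'))"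
  proof (rule billiard_step_predI)
    show "(side_length \<alpha> 0 - s * (1 - w')) * sin (pi - \<phi> - \<alpha>) = (1 - v) * sin (\<phi> + 2 * \<alpha>)"
      unfolding step_simps using s_square_mult w by algebra
  qed (use v w w1 angles s_pos in \<open>simp_all add: step_simps\<close>)
  have 4: "billiard_step \<alpha> (0, pi - \<phi> - \<alpha>, s * (1 - w')) (1, \<phi>, x + \<omega> - 1)"
  proof (rule billiard_step_nextI)
    show "(x + \<omega> - 1) * sin \<phi> = (side_length \<alpha> 0 - s * (1 - w')) * sin (pi - \<phi> - \<alpha>)"
      unfolding step_simps using s_square_mult \<omega>_mult x w by algebra
  qed (use x' w w1 angles s_pos in \<open>simp_all add: step_simps\<close>)
  show ?thesis
    by (rule induced_map_by_path[where bs = "[(2, pi - \<phi> - \<alpha>, s * w), (1, \<phi> + 2 * \<alpha>, 1 - v),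
          (0, pi - \<phi> - \<alpha>, s * (1 - w'))]"])
      (use 1 2 3 4 v w w1 x' assms s_pos cos_pos \<alpha> pi_gt_zero in
        \<open>auto simp del: billiard_step.simps simp: side_lengths base_section_def\<close>)
qed

text \<open>The sequence of outgoing angles is a palindrome about the fifth bounce, which lies at
  \<open>y\<close> on the base. Reversal in time together with the mirror symmetry of the triangle
  exchanges \<open>y\<close> and \<open>1 - y\<close>, so the second half of the path repeats the
  formulas of the first.\<close>

lemma induced_map_left:
  assumes "0 < x" "x < 1 - \<omega>"
  shows "induced_map \<alpha> \<phi> x x' \<longleftrightarrow> x' = x + \<omega>"
proof -
  define y where "y = 1 - x / (1 - \<omega>)"
  have y: "0 < y" "y < 1" and x: "x = (1 - \<omega>) * (1 - y)"
    using assms \<omega>_bounds by (simp_all add: y_def field_simps)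
  have x': "0 < x + \<omega>" "x + \<omega> < 1" "x < 1"
    using assms \<omega>_bounds by linarith+
  \<comment> \<open>The bound \<open>Q < 1\<close> enters here: bounces 2 and 8 are at distances
    \<open>s * (Q * y)\<close> and \<open>s * (Q * (1 - y))\<close> from the base and must not pass
    the apex.\<close>
  have Qy: "0 < Q * y" "Q * y < 1" "0 < Q * (1 - y)" "Q * (1 - y) < 1"
    using y bounds mult_strict_mono[of Q 1 y 1] mult_strict_mono[of Q 1 "1 - y" 1] by simp_all
  have Py: "0 < P * y" "P * y < 1" "0 < P * (1 - y)" "P * (1 - y) < 1"
    using y bounds mult_strict_mono[of P 1 y 1] mult_strict_mono[of P 1 "1 - y" 1] by simp_all
  define w1 where "w1 = (A + Q * y) / (A + 1)"
  define r where "r = P * y / (2 - u)"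
  define q where "q = Q * y / (3 - u\<^sup>2)"
  define q' where "q' = Q * (1 - y) / (3 - u\<^sup>2)"
  define r' where "r' = P * (1 - y) / (2 - u)"
  define w9 where "w9 = (1 - Q * (1 - y)) / (A + 1)"
  have eqs: "w1 * (A + 1) = A + Q * y" "r * (2 - u) = P * y" "q * (3 - u\<^sup>2) = Q * y"
    "q' * (3 - u\<^sup>2) = Q * (1 - y)" "r' * (2 - u) = P * (1 - y)" "w9 * (A + 1) = 1 - Q * (1 - y)"
    using bounds u_bounds by (simp_all add: w1_def r_def q_def q'_def r'_def w9_def)
  have pos: "0 < w1" "0 < r" "0 < q" "0 < q'" "0 < r'" "0 < w9"
    unfolding w1_def r_def q_def q'_def r'_def w9_def
    by (intro divide_pos_pos; use Qy Py bounds u_bounds in linarith)+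
  have less1: "w1 < 1" "r < 1" "q < 1" "q' < 1" "r' < 1" "w9 < 1"
    unfolding w1_def r_def q_def q'_def r'_def w9_def
    by (subst divide_less_eq_1_pos; use Qy Py bounds u_bounds u_square in linarith)+
  note facts = y x' Qy pos less1 angles s_pos
  note eqs = eqs s_square_mult
  have "(1 - x) * (2 - u\<^sup>2) = s * s * (w1 * (A + 1))"
    using eqs \<omega>_mult x by algebra
  then have 1: "billiard_step \<alpha> (1, \<phi>, x) (2, pi - \<phi> - \<alpha>, s * w1)"
    using assms facts by (intro first_step) simp_all
  have 2: "billiard_step \<alpha> (2, pi - \<phi> - \<alpha>, s * w1) (0, \<phi> + 3 * \<alpha> - pi, s * (1 - Q * y))"
  proof (rule billiard_step_nextI)
    show "s * (1 - Q * y) * sin (\<phi> + 3 * \<alpha> - pi) = (side_length \<alpha> 2 - s * w1) * sin (pi - \<phi> - \<alpha>)"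
      unfolding step_simps using eqs by algebra
  qed (use facts in \<open>simp_all add: step_simps\<close>)
  have 3: "billiard_step \<alpha> (0, \<phi> + 3 * \<alpha> - pi, s * (1 - Q * y)) (1, 2 * pi - \<phi> - 4 * \<alpha>, r)"
  proof (rule billiard_step_nextI)
    show "r * sin (2 * pi - \<phi> - 4 * \<alpha>) = (side_length \<alpha> 0 - s * (1 - Q * y)) * sin (\<phi> + 3 * \<alpha> - pi)"
      unfolding step_simps using eqs by algebra
  qed (use facts in \<open>simp_all add: step_simps\<close>)
  have 4: "billiard_step \<alpha> (1, 2 * pi - \<phi> - 4 * \<alpha>, r) (0, \<phi> + 5 * \<alpha> - pi, s * (1 - q))"
  proof (rule billiard_step_predI)
    show "(side_length \<alpha> 0 - s * (1 - q)) * sin (\<phi> + 5 * \<alpha> - pi) = r * sin (2 * pi - \<phi> - 4 * \<alpha>)"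
      unfolding step_simps using eqs by algebra
  qed (use facts in \<open>simp_all add: step_simps\<close>)
  have 5: "billiard_step \<alpha> (0, \<phi> + 5 * \<alpha> - pi, s * (1 - q)) (1, 2 * pi - \<phi> - 6 * \<alpha>, y)"
  proof (rule billiard_step_nextI)
    show "y * sin (2 * pi - \<phi> - 6 * \<alpha>) = (side_length \<alpha> 0 - s * (1 - q)) * sin (\<phi> + 5 * \<alpha> - pi)"
      unfolding step_simps using eqs by algebra
  qed (use facts in \<open>simp_all add: step_simps\<close>)
  have 6: "billiard_step \<alpha> (1, 2 * pi - \<phi> - 6 * \<alpha>, y) (2, \<phi> + 5 * \<alpha> - pi, s * q')"
  proof (rule billiard_step_nextI)
    show "s * q' * sin (\<phi> + 5 * \<alpha> - pi) = (side_length \<alpha> 1 - y) * sin (2 * pi - \<phi> - 6 * \<alpha>)"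
      unfolding step_simps using eqs by algebra
  qed (use facts in \<open>simp_all add: step_simps\<close>)
  have 7: "billiard_step \<alpha> (2, \<phi> + 5 * \<alpha> - pi, s * q') (1, 2 * pi - \<phi> - 4 * \<alpha>, 1 - r')"
  proof (rule billiard_step_predI)
    show "(side_length \<alpha> 1 - (1 - r')) * sin (2 * pi - \<phi> - 4 * \<alpha>) = s * q' * sin (\<phi> + 5 * \<alpha> - pi)"
      unfolding step_simps using eqs by algebra
  qed (use facts in \<open>simp_all add: step_simps\<close>)
  have 8: "billiard_step \<alpha> (1, 2 * pi - \<phi> - 4 * \<alpha>, 1 - r') (2, \<phi> + 3 * \<alpha> - pi, s * (Q * (1 - y)))"
  proof (rule billiard_step_nextI)
    show "s * (Q * (1 - y)) * sin (\<phi> + 3 * \<alpha> - pi) =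
        (side_length \<alpha> 1 - (1 - r')) * sin (2 * pi - \<phi> - 4 * \<alpha>)"
      unfolding step_simps using eqs by algebra
  qed (use facts in \<open>simp_all add: step_simps\<close>)
  have 9: "billiard_step \<alpha> (2, \<phi> + 3 * \<alpha> - pi, s * (Q * (1 - y))) (0, pi - \<phi> - \<alpha>, s * w9)"
  proof (rule billiard_step_nextI)
    show "s * w9 * sin (pi - \<phi> - \<alpha>) = (side_length \<alpha> 2 - s * (Q * (1 - y))) * sin (\<phi> + 3 * \<alpha> - pi)"
      unfolding step_simps using eqs by algebra
  qed (use facts in \<open>simp_all add: step_simps\<close>)
  have 10: "billiard_step \<alpha> (0, pi - \<phi> - \<alpha>, s * w9) (1, \<phi>, x + \<omega>)"
  proof (rule billiard_step_nextI)
    show "(x + \<omega>) * sin \<phi> = (side_length \<alpha> 0 - s * w9) * sin (pi - \<phi> - \<alpha>)"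
      unfolding step_simps using eqs \<omega>_mult x by algebra
  qed (use facts in \<open>simp_all add: step_simps\<close>)
  \<comment> \<open>The intermediate base bounces do not count as returns: equality would force
    \<open>\<phi> + 2 * \<alpha> = pi\<close> or \<open>\<phi> + 3 * \<alpha> = pi\<close>, against
    \<open>angle_2\<close> and \<open>angle_3\<close>.\<close>
  have base: "2 * pi - \<phi> - 4 * \<alpha> \<noteq> \<phi>" "2 * pi - \<phi> - 6 * \<alpha> \<noteq> \<phi>"
    using angles by linarith+
  show ?thesis
    by (rule induced_map_by_path[where bs =
          "[(2, pi - \<phi> - \<alpha>, s * w1), (0, \<phi> + 3 * \<alpha> - pi, s * (1 - Q * y)),
            (1, 2 * pi - \<phi> - 4 * \<alpha>, r), (0, \<phi> + 5 * \<alpha> - pi, s * (1 - q)),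
            (1, 2 * pi - \<phi> - 6 * \<alpha>, y), (2, \<phi> + 5 * \<alpha> - pi, s * q'),
            (1, 2 * pi - \<phi> - 4 * \<alpha>, 1 - r'), (2, \<phi> + 3 * \<alpha> - pi, s * (Q * (1 - y))),
            (0, pi - \<phi> - \<alpha>, s * w9)]"])
      (use 1 2 3 4 5 6 7 8 9 10 facts bounds base assms cos_pos in
        \<open>simp_all del: billiard_step.simps add: side_lengths base_section_def\<close>)
qed

text \<open>The limiting case \<open>v = 1\<close> of the right path: the second bounce is the left
  end of the base.\<close>

lemma meets_corner_middle: "meets_corner \<alpha> \<phi> (1 - \<omega>)"
proof -
  define w where "w = A / (A + 1)"
  have w: "0 < w" "w < 1" "w * (A + 1) = A" using bounds by (simp_all add: w_def)
  define p :: "nat \<Rightarrow> bounce" where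
    "p = (!) [(1, \<phi>, 1 - \<omega>), (2, pi - \<phi> - \<alpha>, s * w), (1, \<phi> + 2 * \<alpha>, 0)]"
  have "(1 - (1 - \<omega>)) * (2 - u\<^sup>2) = s * s * (w * (A + 1))"
    unfolding w using s_square_mult \<omega>_mult by simp
  then have 1: "billiard_step \<alpha> (1, \<phi>, 1 - \<omega>) (2, pi - \<phi> - \<alpha>, s * w)"
    using \<omega>_bounds w by (intro first_step) simp_all
  have 2: "billiard_step \<alpha> (2, pi - \<phi> - \<alpha>, s * w) (1, \<phi> + 2 * \<alpha>, 0)"
    using second_step_right[of 1 w] w by simp
  have "billiard_orbit \<alpha> 2 p"
    using 1 2 by (simp del: billiard_step.simps add: billiard_orbit_def p_def less_2_cases_iff)
  moreover have "\<forall>i. 0 < i \<and> i < 2 \<longrightarrow> p i \<notin> base_section \<phi>"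
    by (auto simp: less_2_cases_iff p_def base_section_def)
  ultimately show ?thesis
    unfolding meets_corner_def
    by (intro exI[of _ 2] exI[of _ p] conjI) (simp_all add: p_def)
qed

lemma induced_map_rotation:
  assumes "x \<in> {0..1} - {0, 1 - \<omega>, 1}"
  shows "induced_map \<alpha> \<phi> x x' \<longleftrightarrow> x' = frac (x + \<omega>)"
proof (cases "x < 1 - \<omega>")
  case True
  then have "frac (x + \<omega>) = x + \<omega>" using assms \<omega>_bounds by (simp add: frac_eq)
  then show ?thesis using induced_map_left[of x x'] True assms by simp
next
  case False
  then have x: "1 - \<omega> < x" "x < 1" using assms by auto
  then have "frac (x + \<omega>) = x + \<omega> - 1"
    using \<omega>_bounds by (simp add: frac_unique_iff)
  then show ?thesis using induced_map_right[of x x'] x by simp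
qed

lemma meets_corner_exceptional:
  assumes "x \<in> {0, 1 - \<omega>, 1}"
  shows "meets_corner \<alpha> \<phi> x"
proof -
  have "meets_corner \<alpha> \<phi> x" if "x = 0 \<or> x = 1"
    unfolding meets_corner_def billiard_orbit_def using that
    by (intro exI[of _ 0] exI[of _ "\<lambda>_. (1, \<phi>, x)"]) (auto simp: side_lengths)
  then show ?thesis using assms meets_corner_middle by blast
qed

end

section \<open>Cosine values at the two ends of the parameter range\<close>

lemma cos_quadruple: "cos (4 * x) = 8 * cos x ^ 4 - 8 * (cos x)\<^sup>2 + 1" for x :: real
proof -
  have "cos (4 * x) = 2 * (2 * (cos x)\<^sup>2 - 1)\<^sup>2 - 1"
    using cos_double_cos[of "2 * x"] by (simp add: cos_double_cos)
  then show ?thesis by algebra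
qed

text \<open>For \<theta> = \<open>4 * pi / 7\<close> the angles 3\<theta> and 4\<theta> add up to
  \<open>4 * pi\<close>, so their cosines agree. In \<open>v\<close> this is a quartic; removing the
  root 2 leaves the cubic of the regular heptagon.\<close>

lemma cos_4_pi_7: "2 * cos (4 * pi / 7) < - (11 / 25)"
proof -
  define v where "v = 2 * cos (4 * pi / 7)"
  have "cos (4 * pi / 7) > cos (2 * pi / 3)" "cos (4 * pi / 7) < cos (pi / 2)"
    by (intro cos_monotone_0_pi; simp)+
  then have v: "- 1 < v" "v < 0" using cos_120' by (simp_all add: v_def field_simps)
  have "cos (3 * (4 * pi / 7)) = cos (4 * (4 * pi / 7))"
    using cos_2pi_minus[of "12 * pi / 7"] cos_periodic[of "2 * pi / 7"] by (simp add: field_simps)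
  moreover have "2 * cos (3 * (4 * pi / 7)) = v ^ 3 - 3 * v"
    unfolding v_def cos_treble_cos by (simp add: power3_eq_cube)
  moreover have "2 * cos (4 * (4 * pi / 7)) = v ^ 4 - 4 * v\<^sup>2 + 2"
    unfolding cos_quadruple v_def by (simp add: power_mult_distrib)
  ultimately have "v ^ 3 - 3 * v = v ^ 4 - 4 * v\<^sup>2 + 2" by linarith
  then have "(v - 2) * (v ^ 3 + v\<^sup>2 - 2 * v - 1) = 0" by algebra
  then have "v ^ 3 + v\<^sup>2 - 2 * v - 1 = 0" using v by simp
  \<comment> \<open>Division of the cubic by \<open>v + 11 / 25\<close>, with remainder
    \<open>- 181 / 15625\<close>. As the cubic vanishes, the product is positive, and its negative
    second factor forces the first to be negative.\<close>
  moreover have "(v + 11 / 25) * (v\<^sup>2 + 14 / 25 * v - 1404 / 625) =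
      v ^ 3 + v\<^sup>2 - 2 * v - 1 + 181 / 15625"
    by (simp add: power2_eq_square power3_eq_cube field_simps)
  moreover have "v\<^sup>2 < 1" using v by (simp add: abs_square_less_1)
  then have "v\<^sup>2 + 14 / 25 * v - 1404 / 625 < 0" using v by simp
  ultimately have "v + 11 / 25 < 0"
    using mult_nonneg_nonpos[of "v + 11 / 25" "v\<^sup>2 + 14 / 25 * v - 1404 / 625"] by linarith
  then show ?thesis by (simp add: v_def)
qed

text \<open>For \<theta> = \<open>3 * pi / 5\<close> the angles 3\<theta> and 2\<theta> add up to
  \<open>3 * pi\<close>, so their cosines are opposite; the resulting cubic has the spurious root
  -2. Hence \<open>1 + u - u\<^sup>2\<close> vanishes at \<alpha> =
  \<open>3 * pi / 10\<close>.\<close>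

lemma cos_3_pi_5: "(2 * cos (3 * pi / 5))\<^sup>2 = 2 * cos (3 * pi / 5) + 1"
proof -
  define v where "v = 2 * cos (3 * pi / 5)"
  have "cos (3 * pi / 5) > cos (2 * pi / 3)"
    by (intro cos_monotone_0_pi; simp)
  then have v: "- 1 < v" using cos_120' by (simp add: v_def field_simps)
  have "cos (3 * (3 * pi / 5)) = - cos (2 * (3 * pi / 5))"
    using cos_periodic_pi[of "4 * pi / 5"] cos_2pi_minus[of "4 * pi / 5"]
    by (simp add: field_simps)
  moreover have "2 * cos (3 * (3 * pi / 5)) = v ^ 3 - 3 * v"
    unfolding v_def cos_treble_cos by (simp add: power3_eq_cube)
  moreover have "2 * cos (2 * (3 * pi / 5)) = v\<^sup>2 - 2"
    unfolding v_def cos_double_cos by (simp add: power2_eq_square)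
  ultimately have "v ^ 3 - 3 * v = 2 - v\<^sup>2" by linarith
  then have "(v + 2) * (v\<^sup>2 - v - 1) = 0" by algebra
  then show ?thesis using v by (simp add: v_def)
qed

section \<open>Choice of the direction and of the lower bound\<close>

lemma rotation_triangle_exists:
  fixes \<alpha> :: real
  assumes "pi / 4 < \<alpha>" "\<alpha> < 3 * pi / 10" "2 * cos (2 * \<alpha>) < - (11 / 25)"
  obtains \<phi> \<kappa> where "rotation_triangle \<alpha> \<phi> (2 * cos (2 * \<alpha>)) \<kappa>"
proof -
  define u where "u = 2 * cos (2 * \<alpha>)"
  define v where "v = 2 * cos (3 * pi / 5)"
  have "cos (2 * \<alpha>) > cos (3 * pi / 5)" "cos (3 * pi / 5) < cos (pi / 2)"
    using assms by (intro cos_monotone_0_pi; simp)+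
  then have v: "v < u" "v < 0" by (simp_all add: u_def v_def)
  have "cos (2 * \<alpha>) > cos (2 * pi / 3)"
    using assms pi_gt_zero by (intro cos_monotone_0_pi) linarith+
  then have u: "- 1 < u" "u < - (11 / 25)" 
    using cos_120' assms by (simp_all add: u_def field_simps)
  have u2: "u\<^sup>2 < 1" using u by (simp add: abs_square_less_1)
  \<comment> \<open>The roots of the quadratic are \<open>v\<close> and \<open>1 - v\<close>, and
    \<open>u\<close> lies strictly between them.\<close>
  have "(u - v) * (1 - u - v) = 1 + u - u\<^sup>2"
    using cos_3_pi_5 unfolding v_def[symmetric] by (simp add: power2_eq_square algebra_simps)
  moreover have "(u - v) * (1 - u - v) > 0" using v u by simp
  ultimately have P: "0 < 1 + u - u\<^sup>2" by simp
  \<comment> \<open>The product is the increment of \<open>(2 + u) * (1 + u - u\<^sup>2)\<close>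
    from its value \<open>1 - 6694 / 15625\<close> at \<open>- 11 / 25\<close>, with the linear
    factor split off.\<close>
  have "(u + 11 / 25) * (3 - (u - 11 / 25) - (u\<^sup>2 - 11 / 25 * u + (11 / 25)\<^sup>2)) < 0"
    using u u2 by (intro mult_neg_pos) (simp_all add: power2_eq_square)
  moreover have "(2 + u) * (1 + u - u\<^sup>2) - 1 = (u + 11 / 25) *
      (3 - (u - 11 / 25) - (u\<^sup>2 - 11 / 25 * u + (11 / 25)\<^sup>2)) - 6694 / 15625"
    by (simp add: power2_eq_square field_simps)
  ultimately have Q: "(2 + u) * (1 + u - u\<^sup>2) < 1" by linarith
  define \<omega> where "\<omega> = (1 - u) / (2 - u\<^sup>2)"
  \<comment> \<open>\<open>t\<close> is the cotangent of the wanted \<phi>: divided by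
    \<open>sin \<phi>\<close>, the condition
    \<open>sin (\<phi> + 2 * \<alpha>) = \<omega> * sin \<phi>\<close> becomes linear in the
    cotangent.\<close>
  define t where "t = (\<omega> - cos (2 * \<alpha>)) / sin (2 * \<alpha>)"
  have "sin (2 * \<alpha>) > 0" using assms pi_gt_zero by (intro sin_gt_zero) linarith+
  then have t: "t * sin (2 * \<alpha>) = \<omega> - cos (2 * \<alpha>)" by (simp add: t_def)
  define \<phi> where "\<phi> = pi / 2 - arctan t"
  have \<phi>: "0 < \<phi>" "\<phi> < pi"
    using arctan_lbound[of t] arctan_ubound[of t] by (simp_all add: \<phi>_def)
  have "sin \<phi> > 0" using \<phi> by (rule sin_gt_zero)
  have "sin \<phi> = cos (arctan t)" "cos \<phi> = sin (arctan t)"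
    by (simp_all add: \<phi>_def sin_diff cos_diff)
  moreover have "sin (arctan t) = t * cos (arctan t)"
    using tan_arctan[of t] by (simp add: tan_def field_simps)
  ultimately have "cos \<phi> = t * sin \<phi>" by simp
  then have "sin (\<phi> + 2 * \<alpha>) = sin \<phi> * \<omega>"
    unfolding sin_add using t by algebra
  then have "rotation_triangle \<alpha> \<phi> u (sin \<phi> / (2 - u\<^sup>2))"
    using assms \<phi> P Q u2 \<open>sin \<phi> > 0\<close>
    by unfold_locales (simp_all add: u_def[symmetric] \<omega>_def)
  then show ?thesis using that by (simp add: u_def)
qed

theorem theorem1:
  shows "\<exists>\<alpha>\<^sub>0::real. pi / 4 < \<alpha>\<^sub>0 \<and> \<alpha>\<^sub>0 < 2 * pi / 7 \<and>
    (\<forall>\<alpha>. \<alpha>\<^sub>0 < \<alpha> \<and> \<alpha> < 3 * pi / 10 \<longrightarrow>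
      (let \<omega> = cos (3 * \<alpha>) / (2 * cos \<alpha> * cos (4 * \<alpha>)) in
        \<exists>\<phi>. 0 < \<phi> \<and> \<phi> < pi \<and>
          (\<forall>x \<in> {0..1} - {0, 1 - \<omega>, 1}. \<forall>x'.
             induced_map \<alpha> \<phi> x x' \<longleftrightarrow> x' = frac (x + \<omega>)) \<and>
          (\<forall>x \<in> {0, 1 - \<omega>, 1}. meets_corner \<alpha> \<phi> x)))"
proof -
  \<comment> \<open>The angle at which \<open>2 * cos (2 * \<alpha>)\<close> equals
    \<open>- 11 / 25\<close>.\<close>
  define \<alpha>\<^sub>0 :: real where "\<alpha>\<^sub>0 = arccos (- (11 / 50)) / 2"
  have "arccos (- (11 / 50)) > arccos 0"
    by (intro arccos_less_arccos) simp_all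
  then have "pi / 4 < \<alpha>\<^sub>0" by (simp add: \<alpha>\<^sub>0_def)
  moreover have "arccos (- (11 / 50)) < arccos (cos (4 * pi / 7))"
    using cos_4_pi_7 by (intro arccos_less_arccos) simp_all
  then have "\<alpha>\<^sub>0 < 2 * pi / 7" by (simp add: \<alpha>\<^sub>0_def arccos_cos)
  moreover have "\<exists>\<phi>. 0 < \<phi> \<and> \<phi> < pi \<and>
      (\<forall>x \<in> {0..1} - {0, 1 - r, 1}. \<forall>x'. induced_map \<alpha> \<phi> x x' \<longleftrightarrow> x' = frac (x + r)) \<and>
      (\<forall>x \<in> {0, 1 - r, 1}. meets_corner \<alpha> \<phi> x)"
    if \<alpha>: "\<alpha>\<^sub>0 < \<alpha>" "\<alpha> < 3 * pi / 10" and r: "r = cos (3 * \<alpha>) / (2 * cos \<alpha> * cos (4 * \<alpha>))"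
    for \<alpha> r
  proof -
    have "cos (2 * \<alpha>) < cos (arccos (- (11 / 50)))"
      using \<alpha> pi_gt_zero arccos_lbound[of "- (11 / 50)"]
      by (intro cos_monotone_0_pi) (simp_all add: \<alpha>\<^sub>0_def)
    then have "2 * cos (2 * \<alpha>) < - (11 / 25)" by (simp add: cos_arccos)
    then obtain \<phi> \<kappa> where "rotation_triangle \<alpha> \<phi> (2 * cos (2 * \<alpha>)) \<kappa>"
      using rotation_triangle_exists \<alpha> \<open>pi / 4 < \<alpha>\<^sub>0\<close> by (meson less_trans)
    then interpret rotation_triangle \<alpha> \<phi> "2 * cos (2 * \<alpha>)" \<kappa> .
    \<comment> \<open>With \<open>u\<close> for \<open>2 * cos (2 * \<alpha>)\<close>, the factor
      \<open>cos \<alpha>\<close> cancels and \<open>r\<close> becomes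
      \<open>(u - 1) / (u\<^sup>2 - 2)\<close>, which is \<omega> with both signs reversed.\<close>
    have "cos (3 * \<alpha>) = cos \<alpha> * (2 * cos (2 * \<alpha>) - 1)"
      unfolding cos_treble_cos cos_double_cos
      by (simp add: power2_eq_square power3_eq_cube algebra_simps)
    moreover have "2 * cos (4 * \<alpha>) = (2 * cos (2 * \<alpha>))\<^sup>2 - 2"
      using cos_double_cos[of "2 * \<alpha>"] by (simp add: power_mult_distrib)
    ultimately have "r = (2 * cos (2 * \<alpha>) - 1) / ((2 * cos (2 * \<alpha>))\<^sup>2 - 2)"
      unfolding r using cos_pos by (simp add: mult.commute mult.left_commute)
    also have "\<dots> = \<omega>"
      unfolding \<omega>_def by (metis minus_diff_eq minus_divide_divide)
    finally show ?thesis
      using \<phi> induced_map_rotation meets_corner_exceptional by auto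
  qed
  ultimately show ?thesis unfolding Let_def by blast
qed

end
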